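(* Let $Q$ be a process on $A^{\mathbb{Z}}$ and $\Theta\subseteq\mathcal{P}_{\mathrm{stat}}(A^{\mathbb{Z}})$. Assume that for each $P\in\Theta$ and $\gamma_P$-almost every $W$ the relative entropy rate $h(W,Q)$ exists and $\bar\beta_\varepsilon(W,Q)\le-h(W,Q)$ for all $\varepsilon\in(0,1)$. Then $\underline{h}(P,Q)\in[0,+\infty]$ exists for all $P\in\Theta$, and for every $\Omega\subseteq\Theta$ and every $\eta>0$ there are subsets $M_n\subseteq A^n$ with $\lim_nP^{(n)}(M_n)=1$ for all $P\in\Omega$, and $\limsup_n\frac1n\log Q^{(n)}(M_n)\le-\underline{h}(\Omega,Q)+\eta$ if $\underline{h}(\Omega,Q)<\infty$, resp. $\le -1/\eta$ if $\underline{h}(\Omega,Q)=\infty$. Moreover every sequence $\tilde M_n\subseteq A^n$ with $\lim_nP^{(n)}(\tilde M_n)=1$ for all $P\in\Omega$ satisfies $\liminf_n\frac1n\log Q^{(n)}(\tilde M_n)\ge-\underline{h}(\Omega,Q)$.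
   Context: $A$ finite set; processes are probability measures on $A^{\mathbb{Z}}$ (cylinder $\sigma$-field); $P^{(n)}$ is the marginal on coordinates $\{0,\dots,n-1\}$. $\mathcal{P}_{\mathrm{stat}}(A^{\mathbb{Z}})$ is the set of shift-invariant processes; each $P$ in it has an ergodic decomposition $P=\int W\,\gamma_P(dW)$ over ergodic processes $W$. $h(W,Q)=\lim_n\frac1nH(W^{(n)},Q^{(n)})$ (when it exists in $[0,\infty]$), $H$ the Kullback–Leibler divergence. $\beta_{\varepsilon,n}(W,Q)=\min\{\log Q^{(n)}(M):M\subseteq A^n,W^{(n)}(M)\ge1-\varepsilon\}$, $\bar\beta_\varepsilon=\limsup_n\frac1n\beta_{\varepsilon,n}$. $\underline{h}(P,Q):=\operatorname{ess\,inf}_{\gamma_P(dW)}h(W,Q)$ and $\underline{h}(\Omega,Q):=\inf_{P\in\Omega}\underline{h}(P,Q)$. *)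

theory Defs
  imports "HOL-Probability.Probability"
begin

definition cyl :: "(int \<Rightarrow> 'a::finite) measure" where
  "cyl = PiM UNIV (\<lambda>_. count_space UNIV)"

definition is_process :: "(int \<Rightarrow> 'a::finite) measure \<Rightarrow> bool" where
  "is_process P \<longleftrightarrow> prob_space P \<and> sets P = sets cyl"

definition shift :: "(int \<Rightarrow> 'a) \<Rightarrow> (int \<Rightarrow> 'a)" where
  "shift x = (\<lambda>i. x (i + 1))"

definition stationary :: "(int \<Rightarrow> 'a::finite) measure \<Rightarrow> bool" where
  "stationary P \<longleftrightarrow> is_process P \<and>
     (\<forall>S \<in> sets cyl. measure P (shift -` S) = measure P S)"

definition ergodic :: "(int \<Rightarrow> 'a::finite) measure \<Rightarrow> bool" where
  "ergodic W \<longleftrightarrow> stationary W \<and>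
     (\<forall>S \<in> sets cyl. shift -` S = S \<longrightarrow> measure W S = 0 \<or> measure W S = 1)"

definition ergodic_decomposition ::
  "(int \<Rightarrow> 'a::finite) measure \<Rightarrow> (int \<Rightarrow> 'a) measure measure \<Rightarrow> bool" where
  "ergodic_decomposition P \<gamma> \<longleftrightarrow> prob_space \<gamma> \<and> sets \<gamma> = sets (prob_algebra cyl) \<and>
     (AE W in \<gamma>. ergodic W) \<and>
     (\<forall>S \<in> sets cyl. measure P S = (\<integral>W. measure W S \<partial>\<gamma>))"

definition words :: "nat \<Rightarrow> 'a list set" where
  "words n = {w. length w = n}"

definition word :: "nat \<Rightarrow> (int \<Rightarrow> 'a) \<Rightarrow> 'a list" where
  "word n x = map (\<lambda>i. x (int i)) [0..<n]"

definition marg :: "(int \<Rightarrow> 'a) measure \<Rightarrow> nat \<Rightarrow> 'a list set \<Rightarrow> real" where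
  "marg P n M = measure P {x \<in> space P. word n x \<in> M}"

definition elog :: "real \<Rightarrow> ereal" where
  "elog t = (if t \<le> 0 then -\<infinity> else ereal (ln t))"

definition KL :: "(int \<Rightarrow> 'a::finite) measure \<Rightarrow> (int \<Rightarrow> 'a) measure \<Rightarrow> nat \<Rightarrow> ereal" where
  "KL W Q n = (\<Sum>w \<in> words n.
      (let p = marg W n {w}; q = marg Q n {w} in
        if p = 0 then 0 else if q = 0 then \<infinity> else ereal (p * ln (p / q))))"

definition rel_rate_exists :: "(int \<Rightarrow> 'a::finite) measure \<Rightarrow> (int \<Rightarrow> 'a) measure \<Rightarrow> bool" where
  "rel_rate_exists W Q \<longleftrightarrow> (\<exists>L. (\<lambda>n. ereal (1 / real n) * KL W Q n) \<longlonglongrightarrow> L)"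

definition rel_rate :: "(int \<Rightarrow> 'a::finite) measure \<Rightarrow> (int \<Rightarrow> 'a) measure \<Rightarrow> ereal" where
  "rel_rate W Q = lim (\<lambda>n. ereal (1 / real n) * KL W Q n)"

definition beta :: "real \<Rightarrow> nat \<Rightarrow> (int \<Rightarrow> 'a::finite) measure \<Rightarrow> (int \<Rightarrow> 'a) measure \<Rightarrow> ereal" where
  "beta \<epsilon> n W Q = Min {elog (marg Q n M) | M. M \<subseteq> words n \<and> marg W n M \<ge> 1 - \<epsilon>}"

definition beta_bar :: "real \<Rightarrow> (int \<Rightarrow> 'a::finite) measure \<Rightarrow> (int \<Rightarrow> 'a) measure \<Rightarrow> ereal" where
  "beta_bar \<epsilon> W Q = limsup (\<lambda>n. ereal (1 / real n) * beta \<epsilon> n W Q)"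

definition ess_inf :: "'b measure \<Rightarrow> ('b \<Rightarrow> ereal) \<Rightarrow> ereal" where
  "ess_inf M f = Sup {c. AE x in M. c \<le> f x}"

definition h_low :: "(int \<Rightarrow> 'a::finite) measure measure \<Rightarrow> (int \<Rightarrow> 'a) measure \<Rightarrow> ereal" where
  "h_low \<gamma>P Q = ess_inf \<gamma>P (\<lambda>W. rel_rate W Q)"

definition h_low_set :: "((int \<Rightarrow> 'a::finite) measure \<Rightarrow> (int \<Rightarrow> 'a) measure measure)
     \<Rightarrow> (int \<Rightarrow> 'a) measure set \<Rightarrow> (int \<Rightarrow> 'a) measure \<Rightarrow> ereal" where
  "h_low_set \<gamma> \<Omega> Q = (INF P \<in> \<Omega>. h_low (\<gamma> P) Q)"

end

theory Submission
  imports Defs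
begin

text \<open>
  There are countably many rational distributions on blocks of finite length. Extend each of them to
  weights on \<open>A\<^sup>n\<close> by independence of consecutive blocks, and let \<open>U\<^sub>n\<close> be a mixture of all these
  weights. Every stationary \<open>W\<close> satisfies \<open>U\<^sub>n \<ge> e\<^bsup>-n\<delta>\<^esup> W\<^sup>(\<^sup>n\<^sup>)\<close> with \<open>W\<close>-probability tending to one,
  since the block distribution of \<open>W\<close> is approximated in relative entropy by a rational one, which
  costs only a constant factor in the mixture. The test sets
  \<open>M\<^sub>n = {w. Q\<^sup>(\<^sup>n\<^sup>) w \<le> e\<^bsup>-nc\<^esup> U\<^sub>n w}\<close> have \<open>Q\<close>-probability at most \<open>e\<^bsup>-nc\<^esup>\<close>. By the assumption on
  \<open>\<beta>\<close> and a Neyman-Pearson argument they are typical for every \<open>W\<close> with \<open>h(W,Q) > c\<close>, and dominated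
  convergence over the ergodic decomposition makes them typical for every \<open>P \<in> \<Omega>\<close>, even if \<open>\<Omega>\<close> is
  uncountable.

  Conversely, \<open>H(W\<^sup>(\<^sup>n\<^sup>), Q\<^sup>(\<^sup>n\<^sup>)) \<ge> - W\<^sup>(\<^sup>n\<^sup>)(M) log Q\<^sup>(\<^sup>n\<^sup>)(M) - 2\<close> for every \<open>M\<close>, and sets that are
  typical for \<open>P\<close> are, along a subsequence, typical for almost every ergodic component of \<open>P\<close>.
\<close>


subsection \<open>Word marginals\<close>

lemma finite_words [simp]: "finite (words n :: 'a::finite list set)"
proof -
  have "words n = {xs :: 'a list. set xs \<subseteq> UNIV \<and> length xs = n}" by (auto simp: words_def)
  then show ?thesis by (simp only: finite_lists_length_eq finite)
qed

lemma card_words: "card (words n :: 'a::finite list set) = CARD('a) ^ n"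
proof -
  have "words n = {xs :: 'a list. set xs \<subseteq> UNIV \<and> length xs = n}" by (auto simp: words_def)
  then show ?thesis by (simp only: card_lists_length_eq finite)
qed

lemma word_in_words [simp]: "word n x \<in> words n"
  by (simp add: words_def word_def)

lemma space_process: "is_process P \<Longrightarrow> space P = UNIV"
  using sets_eq_imp_space_eq[of P cyl] by (simp add: is_process_def cyl_def space_PiM)

lemma cylinder_sets: "{x. word n x \<in> M} \<in> sets (cyl :: (int \<Rightarrow> 'a::finite) measure)"
proof -
  have *: "{x. word n x = w} \<in> sets (cyl :: (int \<Rightarrow> 'a) measure)" if "w \<in> words n" for w
  proof -
    have "{x. word n x = w} = {x \<in> space cyl. \<forall>i\<in>{..<n}. x (int i) = w ! i}"
      using that by (auto simp: word_def words_def cyl_def space_PiM list_eq_iff_nth_eq)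
    also have "\<dots> \<in> sets cyl"
      unfolding cyl_def
    proof (rule sets.sets_Collect_finite_All)
      fix i :: nat
      have "(\<lambda>x. x (int i)) \<in> PiM UNIV (\<lambda>_. count_space (UNIV :: 'a set)) \<rightarrow>\<^sub>M count_space UNIV"
        by (rule measurable_component_singleton) simp
      then show "{x \<in> space (PiM UNIV (\<lambda>_. count_space (UNIV :: 'a set))). x (int i) = w ! i}
          \<in> sets (PiM UNIV (\<lambda>_. count_space UNIV))"
        using measurable_sets[of _ _ _ "{w ! i}"] by (simp add: vimage_def Collect_conj_eq Int_commute)
    qed auto
    finally show ?thesis .
  qed
  have "{x. word n x \<in> M} = (\<Union>w \<in> words n \<inter> M. {x. word n x = w})" by auto
  also have "\<dots> \<in> sets cyl" using * by auto
  finally show ?thesis .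
qed

lemma marg_process: "is_process P \<Longrightarrow> marg P n M = measure P {x. word n x \<in> M}"
  by (simp add: marg_def space_process)

lemma marg_nonneg [simp]: "0 \<le> marg P n M" by (simp add: marg_def)

lemma marg_sum:
  assumes P: "is_process P" and M: "M \<subseteq> words n"
  shows "marg P n M = (\<Sum>w\<in>M. marg P n {w})"
proof -
  interpret prob_space P using P by (simp add: is_process_def)
  have s: "sets P = sets cyl" using P by (simp add: is_process_def)
  have f: "finite M" using M finite_words finite_subset by blast
  have "{x. word n x \<in> M} = (\<Union>w\<in>M. {x. word n x \<in> {w}})" by auto
  then have "measure P {x. word n x \<in> M} = (\<Sum>w\<in>M. measure P {x. word n x \<in> {w}})"
    using finite_measure_finite_Union[OF f, of "\<lambda>w. {x. word n x \<in> {w}}"] cylinder_sets[of n "{_}"]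
    by (auto simp: disjoint_family_on_def s)
  then show ?thesis using P by (simp add: marg_process)
qed

lemma marg_words: "is_process P \<Longrightarrow> marg P n (words n) = 1"
  using prob_space.prob_space[of P] space_process[of P] by (simp add: marg_process is_process_def)

lemma sum_marg_words: "is_process P \<Longrightarrow> (\<Sum>w\<in>words n. marg P n {w}) = 1"
  using marg_sum[of P "words n" n] marg_words[of P n] by simp

lemma marg_mono: "is_process P \<Longrightarrow> M \<subseteq> N \<Longrightarrow> N \<subseteq> words n \<Longrightarrow> marg P n M \<le> marg P n N"
  using marg_sum[of P M n] marg_sum[of P N n] sum_mono2[of N M "\<lambda>w. marg P n {w}"]
    finite_subset[OF _ finite_words, of N n] by auto

lemma marg_le_1: "is_process P \<Longrightarrow> M \<subseteq> words n \<Longrightarrow> marg P n M \<le> 1"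
  using marg_mono[of P M "words n" n] marg_words[of P n] by simp

lemma marg_compl: 
  assumes "is_process P" "M \<subseteq> words n"
  shows "marg P n (words n - M) = 1 - marg P n M"
proof -
  have "marg P n (words n - M) = (\<Sum>w\<in>words n. marg P n {w}) - (\<Sum>w\<in>M. marg P n {w})"
    using assms by (subst marg_sum) (auto intro: sum_diff)
  then show ?thesis using sum_marg_words[OF assms(1)] marg_sum[OF assms] by simp
qed

lemma marg_Un_le:
  assumes "is_process P" "M \<subseteq> words n" "N \<subseteq> words n"
  shows "marg P n (M \<union> N) \<le> marg P n M + marg P n N"
proof -
  have f: "finite M" "finite N" using assms(2,3) finite_words finite_subset by blast+
  have "marg P n (M \<union> N) = (\<Sum>w\<in>M \<union> N. marg P n {w})" using assms by (intro marg_sum) auto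
  also have "\<dots> \<le> (\<Sum>w\<in>M. marg P n {w}) + (\<Sum>w\<in>N. marg P n {w})"
    using f by (simp add: sum_Un sum_nonneg)
  finally show ?thesis using marg_sum[OF assms(1,2)] marg_sum[OF assms(1,3)] by simp
qed

section \<open>Shift invariance and the law of a block\<close>

lemma measure_shift_pow:
  assumes "stationary P"
  shows "S \<in> sets cyl \<Longrightarrow> measure P {x. (shift ^^ j) x \<in> S} = measure P S
     \<and> {x. (shift ^^ j) x \<in> S} \<in> sets (cyl :: (int \<Rightarrow> 'a::finite) measure)"
proof (induction j)
  case (Suc j)
  have "shift \<in> (cyl :: (int \<Rightarrow> 'a) measure) \<rightarrow>\<^sub>M cyl"
    unfolding cyl_def shift_def[abs_def] by (rule measurable_PiM_single') auto
  then have m: "shift -` T \<in> sets cyl" if "T \<in> sets cyl" for T :: "(int \<Rightarrow> 'a) set"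
    using measurable_sets[OF _ that, of shift cyl] by (simp add: cyl_def space_PiM)
  have eq: "{x. (shift ^^ Suc j) x \<in> S} = shift -` {x. (shift ^^ j) x \<in> S}"
    by (auto simp: funpow_swap1)
  show ?case unfolding eq using Suc m assms by (simp add: stationary_def del: vimage_Collect_eq)
qed auto

lemma shift_pow: "(shift ^^ j) x = (\<lambda>i. x (i + int j))"
  by (induction j) (auto simp: shift_def add_ac)

text \<open>The block at position \<open>j\<close> of \<open>word n x\<close> is the initial block
  of the \<open>j\<close>-fold shift of \<open>x\<close>, so shift invariance applies to a cylinder
  event.\<close>

lemma marg_block:
  assumes P: "stationary P" and "j + k \<le> n"
  shows "marg P n {w \<in> words n. take k (drop j w) = v} = marg P k {v}"
proof -
  have pr: "is_process P" using P by (simp add: stationary_def)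
  have "take k (drop j (word n x)) = word k ((shift ^^ j) x)" for x :: "int \<Rightarrow> 'a"
    using assms(2) by (auto simp: word_def shift_pow list_eq_iff_nth_eq add_ac)
  then have "{x. word n x \<in> {w \<in> words n. take k (drop j w) = v}}
      = {x. (shift ^^ j) x \<in> {x. word k x \<in> {v}}}" by auto
  then show ?thesis
    using measure_shift_pow[OF P cylinder_sets[of k "{v}"], of j] pr by (simp add: marg_process)
qed

text \<open>Reading \<open>w\<close> entails reading its block. This keeps block probabilities
  positive along words of positive probability, where their logarithms are taken.\<close>

lemma marg_le_block:
  assumes "stationary P" "j + k \<le> n" "w \<in> words n"
  shows "marg P n {w} \<le> marg P k {take k (drop j w)}"
proof -
  have "marg P n {w} \<le> marg P n {w' \<in> words n. take k (drop j w') = take k (drop j w)}"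
    using assms by (intro marg_mono) (auto simp: stationary_def)
  with marg_block[OF assms(1,2)] show ?thesis by simp
qed

text \<open>Words are grouped by the block they show at position \<open>j\<close>. Each block of a
  long word thus contributes the same expected log-probability.\<close>

lemma sum_marg_block:
  fixes f :: "'a::finite list \<Rightarrow> real"
  assumes P: "stationary P" and le: "j + k \<le> n"
  shows "(\<Sum>w\<in>words n. marg P n {w} * f (take k (drop j w))) = (\<Sum>v\<in>words k. marg P k {v} * f v)"
proof -
  have pr: "is_process P" using P by (simp add: stationary_def)
  let ?g = "\<lambda>w :: 'a list. take k (drop j w)"
  have "(\<Sum>w\<in>words n. marg P n {w} * f (?g w))
      = (\<Sum>v\<in>words k. \<Sum>w | w \<in> words n \<and> ?g w = v. marg P n {w} * f (?g w))"
    using le by (intro sum.group[symmetric] finite_words) (auto simp: words_def)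
  also have "\<dots> = (\<Sum>v\<in>words k. (\<Sum>w | w \<in> words n \<and> ?g w = v. marg P n {w}) * f v)"
    by (auto simp: sum_distrib_right intro!: sum.cong)
  also have "\<dots> = (\<Sum>v\<in>words k. marg P k {v} * f v)"
  proof (rule sum.cong[OF refl])
    fix v
    have "(\<Sum>w | w \<in> words n \<and> ?g w = v. marg P n {w}) = marg P n {w \<in> words n. ?g w = v}"
      using pr by (subst marg_sum[of P "{w \<in> words n. ?g w = v}"]) auto
    then show "(\<Sum>w | w \<in> words n \<and> ?g w = v. marg P n {w}) * f v = marg P k {v} * f v"
      by (simp only: marg_block[OF assms])
  qed
  finally show ?thesis .
qed

subsection \<open>A universal mixture\<close>

text \<open>If \<open>k\<close> does not divide \<open>n\<close>, the last \<open>n mod k\<close> letters do not contribute to the product.\<close>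

definition block_weight :: "nat \<Rightarrow> ('a list \<Rightarrow> real) \<Rightarrow> nat \<Rightarrow> 'a list \<Rightarrow> real" where
  "block_weight k p n w = (\<Prod>j<n div k. p (take k (drop (j * k) w)))"

lemma block_weight_append:
  assumes "0 < k" "length u = k"
  shows "block_weight k p (k + n) (u @ v) = p u * block_weight k p n v"
proof -
  have d: "(k + n) div k = Suc (n div k)" using assms by simp
  show ?thesis unfolding block_weight_def d prod.lessThan_Suc_shift using assms by simp
qed

lemma words_add: "words (k + n) = (\<lambda>(u, v). u @ v) ` (words k \<times> words n)"
proof -
  have "w \<in> (\<lambda>(u, v). u @ v) ` (words k \<times> words n)" if "length w = k + n" for w :: "'a list"
    using that by (intro image_eqI[of _ _ "(take k w, drop k w)"]) (auto simp: words_def)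
  then show ?thesis by (auto simp: words_def)
qed

text \<open>Splitting off the first block multiplies the sum by the total mass of \<open>p\<close>,
  which is at most 1. Once fewer than \<open>k\<close> letters remain, the product is empty and the
  sum just counts words, whence the bound \<open>CARD('a) ^ k\<close> instead of 1.\<close>

lemma sum_block_weight_le:
  fixes p :: "'a::finite list \<Rightarrow> real"
  assumes k: "0 < k" and p: "\<And>v. 0 \<le> p v" "(\<Sum>v\<in>words k. p v) \<le> 1"
  shows "(\<Sum>w\<in>words n. block_weight k p n w) \<le> real CARD('a) ^ k"
proof (induction n rule: less_induct)
  case (less n)
  show ?case
  proof (cases "n < k")
    case True
    have "1 \<le> CARD('a)" by (simp add: Suc_leI)
    then have "real CARD('a) ^ n \<le> real CARD('a) ^ k" using True by (intro power_increasing) auto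
    then show ?thesis using True by (simp add: block_weight_def card_words)
  next
    case False
    then obtain m where n: "n = k + m" using le_Suc_ex by (metis not_less)
    have inj: "inj_on (\<lambda>(u, v). u @ v) (words k \<times> words m :: ('a list \<times> 'a list) set)"
      by (auto simp: inj_on_def words_def)
    have "(\<Sum>w\<in>words n. block_weight k p n w)
        = (\<Sum>(u, v)\<in>words k \<times> words m. p u * block_weight k p m v)"
      unfolding n words_add sum.reindex[OF inj]
      using k by (intro sum.cong) (auto simp: block_weight_append words_def)
    also have "\<dots> = (\<Sum>u\<in>words k. p u) * (\<Sum>v\<in>words m. block_weight k p m v)"
      by (simp add: sum.cartesian_product[symmetric] sum_product)
    also have "\<dots> \<le> 1 * real CARD('a) ^ k"
      using less[of m] p k n by (intro mult_mono) (auto intro!: sum_nonneg prod_nonneg simp: block_weight_def)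
    finally show ?thesis by simp
  qed
qed

text \<open>A code \<open>(k, xs)\<close> stands for the block length \<open>k + 1\<close> and the empirical distribution of the list
  \<open>xs\<close>, so that all rational block distributions are indexed by a countable type.\<close>

definition code_weight :: "nat \<times> 'a::finite list list \<Rightarrow> nat \<Rightarrow> 'a list \<Rightarrow> real" where
  "code_weight c n w = block_weight (Suc (fst c)) (\<lambda>v. real (count (mset (snd c)) v) / real (length (snd c))) n w
     / real CARD('a) ^ Suc (fst c)"

text \<open>The denominator \<open>CARD('a) ^ Suc (fst c)\<close> pays for the leftover letters. The
  block distribution may have mass below 1, since the list can contain words of other lengths; the
  empty list gives mass 0 because division by zero is 0.\<close>

lemma sum_code_weight_le: "(\<Sum>w\<in>words n. code_weight c n w) \<le> 1"
proof -
  let ?L = "mset (snd c)"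
  have "(\<Sum>v\<in>words k. count ?L v) \<le> length (snd c)" for k
  proof -
    have "(\<Sum>v\<in>words k. count ?L v) = (\<Sum>v\<in>words k \<inter> set_mset ?L. count ?L v)"
      by (intro sum.mono_neutral_right) (auto simp: count_eq_zero_iff)
    also have "\<dots> \<le> (\<Sum>v\<in>set_mset ?L. count ?L v)" by (intro sum_mono2) auto
    finally show ?thesis by (simp add: size_multiset_overloaded_eq flip: size_mset)
  qed
  then have "(\<Sum>v\<in>words k. real (count ?L v) / real (length (snd c))) \<le> 1" for k
    by (simp add: sum_divide_distrib[symmetric] divide_le_eq_1 flip: of_nat_sum)
  from sum_block_weight_le[OF _ _ this, of "Suc (fst c)" n] show ?thesis
    by (simp add: code_weight_def sum_divide_distrib[symmetric])
qed

lemma code_weight_nonneg: "0 \<le> code_weight c n w"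
  by (auto simp: code_weight_def block_weight_def intro!: divide_nonneg_nonneg prod_nonneg)

lemma code_weight_le_1: "w \<in> words n \<Longrightarrow> code_weight c n w \<le> 1"
  using member_le_sum[of w "words n" "code_weight c n"] sum_code_weight_le[where c = c and n = n]
  by (auto simp: code_weight_nonneg)

text \<open>A mixture with geometric prior over an enumeration of all codes; repetitions in the
  enumeration are harmless.\<close>

definition universal_weight :: "nat \<Rightarrow> 'a::finite list \<Rightarrow> real" where
  "universal_weight n w = (\<Sum>c. (1/2) ^ Suc c * code_weight (from_nat c) n w)"

lemma summable_universal: 
  assumes "w \<in> words n"
  shows "summable (\<lambda>c. (1/2) ^ Suc c * code_weight (from_nat c) n w)"
proof (rule summable_comparison_test)
  show "\<exists>N. \<forall>c\<ge>N. norm ((1/2) ^ Suc c * code_weight (from_nat c) n w) \<le> (1/2) ^ Suc c"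
    using code_weight_le_1[OF assms] by (auto simp: code_weight_nonneg abs_mult)
  show "summable (\<lambda>c. (1/2 :: real) ^ Suc c)" using power_half_series sums_summable by blast
qed

lemma sum_universal_weight_le: "(\<Sum>w\<in>words n. universal_weight n (w :: 'a::finite list)) \<le> 1"
proof -
  let ?f = "\<lambda>c w. (1/2) ^ Suc c * code_weight (from_nat c) n (w :: 'a list)"
  have "(\<Sum>w\<in>words n. universal_weight n (w :: 'a list)) = (\<Sum>c. \<Sum>w\<in>words n. ?f c w)"
    unfolding universal_weight_def by (rule suminf_sum[symmetric]) (rule summable_universal)
  also have "\<dots> \<le> (\<Sum>c. (1/2) ^ Suc c)"
  proof (rule suminf_le)
    show "(\<Sum>w\<in>words n. ?f c w) \<le> (1/2) ^ Suc c" for c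
      using sum_code_weight_le[where c = "from_nat c :: nat \<times> 'a list list" and n = n]
      by (simp only: sum_distrib_left[symmetric] mult_left_le zero_le_power zero_le_divide_1_iff zero_le_numeral)
    show "summable (\<lambda>c. \<Sum>w\<in>words n. ?f c w)" by (intro summable_sum summable_universal)
    show "summable (\<lambda>c. (1/2 :: real) ^ Suc c)" using power_half_series sums_summable by blast
  qed
  also have "\<dots> = 1" using power_half_series sums_unique by metis
  finally show ?thesis .
qed

text \<open>Only the term with index \<open>to_nat c\<close> of the nonnegative series is kept. Its
  factor does not depend on \<open>n\<close>, so it disappears on the exponential scale.\<close>

lemma code_le_universal_weight:
  assumes "w \<in> words n"
  shows "(1/2) ^ Suc (to_nat c) * code_weight c n w \<le> universal_weight n w"
  unfolding universal_weight_def
  using sum_le_suminf[OF summable_universal[OF assms], of "{to_nat c}"]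
  by (simp add: code_weight_nonneg)

lemma universal_weight_nonneg: "w \<in> words n \<Longrightarrow> 0 \<le> universal_weight n w"
  unfolding universal_weight_def by (intro suminf_nonneg summable_universal) (auto simp: code_weight_nonneg)

text \<open>Each \<open>N * q v\<close> is rounded up to an integer count. This only increases the
  numerators and makes the total at most \<open>N + card S\<close>, a relative loss that vanishes
  for large \<open>N\<close>.\<close>

lemma rational_approx:
  fixes q :: "'b \<Rightarrow> real"
  assumes S: "finite S" and q: "\<And>v. v \<in> S \<Longrightarrow> 0 \<le> q v" "sum q S = 1" and d: "0 < \<delta>"
  obtains xs where "\<And>v. v \<in> S \<Longrightarrow> exp (- \<delta>) * q v \<le> real (count (mset xs) v) / real (length xs)"
proof -
  define K where "K = real (card S)"
  have "exp (- \<delta>) < 1" using d by simp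
  \<comment> \<open>The condition on \<open>N\<close> is a rearrangement of
    \<open>exp (- \<delta>) * (N + K) < N\<close>.\<close>
  then obtain N :: nat where N: "N > K * exp (- \<delta>) / (1 - exp (- \<delta>))" 
    using reals_Archimedean2 by blast
  with \<open>exp (- \<delta>) < 1\<close> have N': "K * exp (- \<delta>) < N * (1 - exp (- \<delta>))"
    by (simp add: pos_divide_less_eq)
  have K0: "0 \<le> K" by (simp add: K_def)
  have Npos: "N > 0"
  proof (rule ccontr)
    assume "\<not> N > 0"
    then have "K * exp (- \<delta>) < 0" using N' by simp
    moreover have "0 \<le> K * exp (- \<delta>)" using K0 by simp
    ultimately show False by linarith
  qed
  define L where "L = (\<Sum>v\<in>S. replicate_mset (nat \<lceil>N * q v\<rceil>) v)"
  have c: "count L v = nat \<lceil>N * q v\<rceil>" if "v \<in> S" for v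
    using that S by (simp add: L_def count_sum)
  have "size L = (\<Sum>v\<in>S. nat \<lceil>N * q v\<rceil>)" by (simp add: L_def)
  then have "real (size L) = (\<Sum>v\<in>S. real (nat \<lceil>N * q v\<rceil>))" by simp
  also have "\<dots> \<le> (\<Sum>v\<in>S. N * q v + 1)"
  proof (rule sum_mono)
    fix v assume "v \<in> S"
    then have "0 \<le> N * q v" using q(1) by simp
    then have "real (nat \<lceil>N * q v\<rceil>) = of_int \<lceil>N * q v\<rceil>" by (intro of_nat_nat) simp
    then show "real (nat \<lceil>N * q v\<rceil>) \<le> N * q v + 1" by linarith
  qed
  also have "\<dots> = N + K" by (simp add: sum.distrib K_def q(2) flip: sum_distrib_left)
  finally have sz: "real (size L) \<le> N + K" .
  have key: "exp (- \<delta>) * q v \<le> real (count L v) / real (size L)" if v: "v \<in> S" for v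
  proof (cases "q v = 0")
    case False
    then have qv: "0 < q v" using q(1)[OF v] by simp
    have "N * q v \<le> real (count L v)" using c[OF v] by (simp add: real_nat_ceiling_ge)
    have "0 < real (count L v)" using \<open>N * q v \<le> _\<close> qv Npos mult_pos_pos[of N "q v"] by linarith
    then have "0 < size L" by (cases "L = {#}") (auto simp: nonempty_has_size)
    have "exp (- \<delta>) * real (size L) \<le> exp (- \<delta>) * (N + K)" using sz by (intro mult_left_mono) auto
    also have "\<dots> \<le> N" using N' by (simp add: algebra_simps)
    finally have "exp (- \<delta>) * real (size L) * q v \<le> N * q v" using qv by (intro mult_right_mono) auto
    also note \<open>N * q v \<le> _\<close>
    finally show ?thesis using \<open>0 < size L\<close> by (simp add: pos_le_divide_eq mult_ac)
  qed simp
  obtain xs where xs: "mset xs = L" using ex_mset by blast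
  from key show ?thesis unfolding xs[symmetric] size_mset by (rule that)
qed


section \<open>Block entropy and domination of stationary laws by the mixture\<close>

definition block_entropy :: "(int \<Rightarrow> 'a) measure \<Rightarrow> nat \<Rightarrow> real" where
  "block_entropy P n = (\<Sum>w\<in>words n. marg P n {w} * - ln (marg P n {w}))"

lemma block_entropy_nonneg:
  assumes "is_process P"
  shows "0 \<le> block_entropy P n"
  unfolding block_entropy_def
proof (rule sum_nonneg)
  fix w :: "'a list" assume "w \<in> words n"
  then have "marg P n {w} \<le> 1" using marg_le_1[OF assms, of "{w}" n] by simp
  then have "0 \<le> - ln (marg P n {w})"
    using marg_nonneg[of P n "{w}"] by (cases "marg P n {w} = 0") (auto simp: less_le)
  then show "0 \<le> marg P n {w} * - ln (marg P n {w})" by (intro mult_nonneg_nonneg) auto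
qed

text \<open>Choosing \<open>k\<close> with \<open>H(P\<^sub>k) / k\<close> close to \<open>h = inf H(P\<^sub>n) / n\<close> makes convergence of the
  entropy rate unnecessary: \<open>H(P\<^sub>n) \<ge> n h\<close> holds for every \<open>n\<close>.\<close>

lemma expected_log_universal:
  fixes P :: "(int \<Rightarrow> 'a::finite) measure" and \<delta> :: real
  assumes P: "stationary P" and d: "0 < \<delta>"
  shows "\<exists>C. (\<forall>n. (\<Sum>w\<in>words n. marg P n {w} * (ln (marg P n {w}) - ln (universal_weight n w))) \<le> C + \<delta> * n)
    \<and> (\<forall>n. \<forall>w\<in>words n. 0 < marg P n {w} \<longrightarrow> 0 < universal_weight n w)"
proof -
  have pr: "is_process P" using P by (simp add: stationary_def)
  define h where "h = (INF k. block_entropy P (Suc k) / Suc k)"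
  have bdd: "bdd_below (range (\<lambda>k. block_entropy P (Suc k) / Suc k))"
    by (rule bdd_belowI[of _ 0]) (auto simp: block_entropy_nonneg[OF pr])
  have h0: "0 \<le> h" unfolding h_def by (rule cINF_greatest) (auto simp: block_entropy_nonneg[OF pr])
  have hle: "n * h \<le> block_entropy P n" for n
  proof (cases n)
    case (Suc m)
    have "h \<le> block_entropy P (Suc m) / Suc m" unfolding h_def by (rule cINF_lower[OF bdd]) simp
    then show ?thesis using Suc by (simp add: pos_le_divide_eq mult.commute)
  qed (simp add: block_entropy_nonneg[OF pr])
  have "h < h + \<delta> / 2" using d by simp
  then obtain k0 where k0: "block_entropy P (Suc k0) / Suc k0 < h + \<delta> / 2"
    unfolding h_def by (subst (asm) (1) cINF_less_iff[OF _ bdd]) auto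
  define k where "k = Suc k0"
  have kpos: "0 < k" by (simp add: k_def)
  have Hk: "block_entropy P k \<le> k * (h + \<delta> / 2)"
    using k0 by (simp add: k_def pos_divide_less_eq mult.commute del: of_nat_Suc)
  define q where "q v = marg P k {v}" for v
  obtain xs where xs: "\<And>v. v \<in> words k \<Longrightarrow> exp (- (\<delta>/2)) * q v \<le> real (count (mset xs) v) / real (length xs)"
    using rational_approx[of "words k" q "\<delta>/2"] d sum_marg_words[OF pr, of k] by (auto simp: q_def)
  define c where "c = (k0, xs)"
  \<comment> \<open>The total loss independent of \<open>n\<close>: the prior weight of the code
    \<open>c\<close> and the normalisation in \<open>code_weight\<close>.\<close>
  define D where "D = (1/2) ^ Suc (to_nat c) / real CARD('a) ^ k"
  have D0: "0 < D" by (simp add: D_def)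
  define bl where "bl j w = take k (drop (j * k) w)" for j and w :: "'a list"
  have jk: "j * k + k \<le> n" if "j < n div k" for j n
  proof -
    have "Suc j * k \<le> n div k * k" using that by (intro mult_le_mono1) simp
    also have "\<dots> \<le> n" by simp
    finally show ?thesis by simp
  qed
  have blw: "bl j w \<in> words k" if "w \<in> words n" "j < n div k" for j n w
    using that jk[of j n] by (simp add: bl_def words_def)
  \<comment> \<open>The mixture is reduced to the code \<open>c\<close>, whose block distribution is
    at least the true one up to a factor \<open>exp (- (\<delta>/2))\<close> per block.\<close>
  have low: "D * (\<Prod>j<n div k. exp (- (\<delta>/2)) * q (bl j w)) \<le> universal_weight n w"
    if w: "w \<in> words n" for n w
  proof -
    have "(\<Prod>j<n div k. exp (- (\<delta>/2)) * q (bl j w))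
       \<le> (\<Prod>j<n div k. real (count (mset xs) (bl j w)) / real (length xs))"
      using xs blw[OF w] by (intro prod_mono) (auto simp: q_def)
    also have "\<dots> = code_weight c n w * real CARD('a) ^ k"
      by (simp add: code_weight_def block_weight_def c_def k_def bl_def)
    finally have "D * (\<Prod>j<n div k. exp (- (\<delta>/2)) * q (bl j w)) \<le> D * (code_weight c n w * real CARD('a) ^ k)"
      using D0 by (intro mult_left_mono) auto
    also have "\<dots> = (1/2) ^ Suc (to_nat c) * code_weight c n w" by (simp add: D_def)
    also have "\<dots> \<le> universal_weight n w" by (rule code_le_universal_weight[OF w])
    finally show ?thesis .
  qed
  have qpos: "0 < q (bl j w)" if "w \<in> words n" "j < n div k" "0 < marg P n {w}" for j n w
    using marg_le_block[OF P jk[OF that(2)] that(1)] that(3) by (simp add: q_def bl_def)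
  have prpos: "0 < D * (\<Prod>j<n div k. exp (- (\<delta>/2)) * q (bl j w))"
    if "w \<in> words n" "0 < marg P n {w}" for n w
    using qpos[OF that(1) _ that(2)] D0 by (intro mult_pos_pos prod_pos) auto
  have pos: "0 < universal_weight n w" if "w \<in> words n" "0 < marg P n {w}" for n w
    using low[OF that(1)] prpos[OF that] by linarith
  have lnU: "ln D + (\<Sum>j<n div k. ln (q (bl j w)) - \<delta>/2) \<le> ln (universal_weight n w)"
    if w: "w \<in> words n" "0 < marg P n {w}" for n w
  proof -
    have q0: "\<And>j. j < n div k \<Longrightarrow> 0 < q (bl j w)" using qpos w by blast
    have "ln (D * (\<Prod>j<n div k. exp (- (\<delta>/2)) * q (bl j w))) = ln D + (\<Sum>j<n div k. ln (exp (- (\<delta>/2)) * q (bl j w)))"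
      using D0 q0 by (subst ln_mult_pos) (auto intro!: prod_pos ln_prod simp: less_imp_neq[symmetric])
    also have "\<dots> = ln D + (\<Sum>j<n div k. ln (q (bl j w)) - \<delta>/2)"
      using q0 by (simp add: ln_mult_pos)
    finally have "ln D + (\<Sum>j<n div k. ln (q (bl j w)) - \<delta>/2)
      = ln (D * (\<Prod>j<n div k. exp (- (\<delta>/2)) * q (bl j w)))" by simp
    also have "\<dots> \<le> ln (universal_weight n w)" using low[OF w(1)] prpos[OF w] pos[OF w] by simp
    finally show ?thesis .
  qed
  \<comment> \<open>With the lower bound for \<open>ln U\<close> inserted, the expectation is a
    constant minus the entropy of \<open>n\<close> letters plus \<open>n div k\<close> block
    entropies and rounding losses. The entropy terms cancel up to \<open>n * \<delta> / 2\<close>,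
    the slack in the choice of \<open>k\<close>; rounding costs at most another
    \<open>n * \<delta> / 2\<close>.\<close>
  have bound: "(\<Sum>w\<in>words n. marg P n {w} * (ln (marg P n {w}) - ln (universal_weight n w))) \<le> - ln D + \<delta> * n" for n
  proof -
    let ?m = "n div k"
    let ?p = "\<lambda>w. marg P n {w}"
    have "(\<Sum>w\<in>words n. ?p w * (ln (?p w) - ln (universal_weight n w)))
       \<le> (\<Sum>w\<in>words n. ?p w * (ln (?p w) - (ln D + (\<Sum>j<?m. ln (q (bl j w)) - \<delta>/2))))"
    proof (rule sum_mono)
      fix w :: "'a list" assume "w \<in> words n"
      then show "?p w * (ln (?p w) - ln (universal_weight n w))
         \<le> ?p w * (ln (?p w) - (ln D + (\<Sum>j<?m. ln (q (bl j w)) - \<delta>/2)))"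
        using lnU[of w n] marg_nonneg[of P n "{w}"] by (cases "?p w = 0") (auto intro!: mult_left_mono)
    qed
    also have "\<dots> = (\<Sum>w\<in>words n. ?p w * (?m * \<delta> / 2 - ln D) - ?p w * - ln (?p w) + (\<Sum>j<?m. ?p w * - ln (q (bl j w))))"
      by (intro sum.cong) (auto simp: algebra_simps sum_subtractf sum_distrib_left sum_negf)
    also have "\<dots> = (?m * \<delta> / 2 - ln D) - block_entropy P n + (\<Sum>j<?m. \<Sum>w\<in>words n. ?p w * - ln (q (bl j w)))"
      unfolding sum.distrib sum_subtractf sum_distrib_right[symmetric] block_entropy_def
        sum_marg_words[OF pr] by (subst sum.swap) simp
    also have "(\<Sum>j<?m. \<Sum>w\<in>words n. ?p w * - ln (q (bl j w))) = (\<Sum>j<?m. block_entropy P k)"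
    proof (rule sum.cong[OF refl])
      fix j assume "j \<in> {..<?m}"
      then have "j * k + k \<le> n" using jk by simp
      from sum_marg_block[OF P this, of "\<lambda>v. - ln (q v)"]
      show "(\<Sum>w\<in>words n. ?p w * - ln (q (bl j w))) = block_entropy P k"
        by (simp add: bl_def q_def block_entropy_def)
    qed
    also have "\<dots> \<le> (?m * k) * (h + \<delta> / 2)" using Hk by (simp add: mult_left_mono mult.assoc)
    also have "\<dots> \<le> n * (h + \<delta> / 2)"
      using h0 d by (intro mult_right_mono) (auto simp flip: of_nat_mult)
    also have "?m * \<delta> / 2 \<le> n * \<delta> / 2" using d by (simp add: div_le_dividend mult_right_mono)
    finally show ?thesis using hle[of n] by (simp add: algebra_simps)
  qed
  show ?thesis using bound pos by (intro exI[of _ "- ln D"]) auto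
qed

text \<open>This is \<open>ln x \<le> x - 1\<close> at \<open>x = b / a\<close>: the termwise form
  of nonnegativity of relative entropy, which also serves for partial sums and for weights of total
  mass below 1.\<close>

lemma mult_ln_diff_ge:
  fixes a b :: real
  assumes "0 \<le> a" "0 \<le> b" "0 < a \<Longrightarrow> 0 < b"
  shows "a - b \<le> a * (ln a - ln b)"
proof (cases "a = 0")
  case False
  then have ab: "0 < a" "0 < b" using assms by auto
  have "ln (b / a) \<le> b / a - 1" using ab by (intro ln_le_minus_one) auto
  then have "a * (ln b - ln a) \<le> a * (b / a - 1)" using ab by (intro mult_left_mono) (auto simp: ln_div)
  then show ?thesis using ab by (simp add: algebra_simps)
qed (use assms in auto)

text \<open>Markov's inequality applied to \<open>ln (P / U)\<close>, whose negative part has expectation at least \<open>- 1\<close>.\<close>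

lemma universal_weight_dominates:
  fixes P :: "(int \<Rightarrow> 'a::finite) measure" and \<delta> :: real
  assumes P: "stationary P" and d: "0 < \<delta>"
  shows "(\<lambda>n. marg P n {w \<in> words n. universal_weight n w < exp (- (n * \<delta>)) * marg P n {w}}) \<longlonglongrightarrow> 0"
proof -
  have pr: "is_process P" using P by (simp add: stationary_def)
  let ?G = "\<lambda>n. {w \<in> words n. universal_weight n w < exp (- (n * \<delta>)) * marg P n {w}}"
  have "eventually (\<lambda>n. marg P n (?G n) < e) sequentially" if e: "0 < e" for e
  proof -
    \<comment> \<open>With this slack, division by \<open>n * \<delta>\<close> in Markov's
      inequality leaves \<open>e / 2\<close> plus a term of order \<open>1 / n\<close>.\<close>
    have ed: "0 < e * \<delta> / 2" using e d by simp
    obtain C where C: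
      "\<And>n. (\<Sum>w\<in>words n. marg P n {w} * (ln (marg P n {w}) - ln (universal_weight n w))) \<le> C + e * \<delta> / 2 * n"
      "\<And>n w. w \<in> words n \<Longrightarrow> 0 < marg P n {w} \<Longrightarrow> 0 < universal_weight n w"
      using expected_log_universal[OF P ed] by auto
    have main: "marg P n (?G n) * (n * \<delta>) \<le> C + 1 + e * \<delta> / 2 * n" for n
    proof -
      let ?f = "\<lambda>w. marg P n {w} * (ln (marg P n {w}) - ln (universal_weight n w))"
      have "marg P n (?G n) * (n * \<delta>) = (\<Sum>w\<in>?G n. marg P n {w} * (n * \<delta>))"
        using pr by (subst marg_sum) (auto simp: sum_distrib_right)
      also have "\<dots> \<le> (\<Sum>w\<in>?G n. ?f w)"
      proof (rule sum_mono)
        fix w assume w: "w \<in> ?G n"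
        show "marg P n {w} * (n * \<delta>) \<le> ?f w"
        proof (cases "marg P n {w} = 0")
          case False
          then have p: "0 < marg P n {w}" using marg_nonneg[of P n "{w}"] by linarith
          with w C(2) have u: "0 < universal_weight n w" by auto
          have "ln (universal_weight n w) \<le> ln (exp (- (n * \<delta>)) * marg P n {w})" using w u p by auto
          also have "\<dots> = - (n * \<delta>) + ln (marg P n {w})" using p by (simp add: ln_mult_pos)
          finally show ?thesis using p by (intro mult_left_mono) auto
        qed simp
      qed
      finally have 1: "marg P n (?G n) * (n * \<delta>) \<le> (\<Sum>w\<in>?G n. ?f w)" .
      have "- 1 \<le> - (\<Sum>w\<in>words n. universal_weight n (w :: 'a list))"
        using sum_universal_weight_le[where 'a = 'a and n = n] by simp
      also have "\<dots> \<le> - (\<Sum>w\<in>words n - ?G n. universal_weight n (w :: 'a list))"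
        by (simp, intro sum_mono2) (auto simp: universal_weight_nonneg)
      also have "\<dots> = (\<Sum>w\<in>words n - ?G n. - universal_weight n w)" by (simp add: sum_negf)
      also have "\<dots> \<le> (\<Sum>w\<in>words n - ?G n. ?f w)"
      proof (rule sum_mono)
        fix w assume "w \<in> words n - ?G n"
        then show "- universal_weight n w \<le> ?f w"
          using mult_ln_diff_ge[of "marg P n {w}" "universal_weight n w"] C(2)[of w n]
            marg_nonneg[of P n "{w}"] universal_weight_nonneg[of w n] by (smt (verit) DiffD1)
      qed
      finally have 2: "- 1 \<le> (\<Sum>w\<in>words n - ?G n. ?f w)" .
      have "(\<Sum>w\<in>words n. ?f w) = (\<Sum>w\<in>words n - ?G n. ?f w) + (\<Sum>w\<in>?G n. ?f w)"
        by (intro sum.subset_diff) auto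
      then show ?thesis using 1 2 C(1)[of n] by linarith
    qed
    have "(\<lambda>n. (C + 1) / \<delta> / real n) \<longlonglongrightarrow> 0" by (rule lim_const_over_n)
    then have "eventually (\<lambda>n. (C + 1) / \<delta> / real n < e / 2) sequentially"
      using e by (intro order_tendstoD) auto
    then show ?thesis using eventually_gt_at_top[of 0]
    proof eventually_elim
      case (elim n)
      then have nd: "0 < n * \<delta>" using d by simp
      have "C + 1 < e / 2 * (n * \<delta>)" using elim d by (simp add: field_simps)
      then have "marg P n (?G n) * (n * \<delta>) < e * (n * \<delta>)" using main[of n] by (simp add: algebra_simps)
      then show ?case using nd by (simp only: mult_less_cancel_right_pos)
    qed
  qed
  then show ?thesis
    by (intro order_tendstoI) (auto intro!: always_eventually simp: less_le_trans)
qed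


subsection \<open>Universal likelihood-ratio tests\<close>

lemma elog_rate_lessD:
  assumes "0 < n" "ereal (1 / real n) * elog t < ereal (- c)"
  shows "t \<le> exp (- (n * c))"
proof (cases "t \<le> 0")
  case False
  then have "ln t < - (n * c)" using assms by (simp add: elog_def field_simps)
  then have "exp (ln t) \<le> exp (- (n * c))" by (simp only: exp_le_cancel_iff)
  then show ?thesis using False by simp
qed (meson exp_ge_zero order_trans)

lemma elog_rate_leI:
  assumes "0 < n" "t \<le> exp (- (n * c))"
  shows "ereal (1 / real n) * elog t \<le> ereal (- c)"
proof (cases "t \<le> 0")
  case False
  then have "ln t \<le> ln (exp (- (n * c)))" using assms by (intro ln_mono) auto
  then show ?thesis using False assms by (simp add: elog_def field_simps)
qed (use assms in \<open>simp add: elog_def\<close>)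

text \<open>The set of candidate values is finite, and nonempty because all of
  \<open>words n\<close> qualifies.\<close>

lemma beta_attained:
  fixes W Q :: "(int \<Rightarrow> 'a::finite) measure"
  assumes "is_process W" "0 \<le> \<epsilon>"
  obtains M where "M \<subseteq> words n" "1 - \<epsilon> \<le> marg W n M" "beta \<epsilon> n W Q = elog (marg Q n M)"
proof -
  let ?S = "{elog (marg Q n M) | M. M \<subseteq> words n \<and> marg W n M \<ge> 1 - \<epsilon>}"
  have "?S \<subseteq> (\<lambda>M. elog (marg Q n M)) ` Pow (words n)" by auto
  then have "finite ?S" by (rule finite_subset) simp
  moreover have "elog (marg Q n (words n)) \<in> ?S" using assms marg_words[OF assms(1), of n] by auto
  ultimately have "Min ?S \<in> ?S" by (intro Min_in) auto
  then show ?thesis using that unfolding beta_def by auto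
qed

text \<open>A likelihood-ratio test of \<open>Q\<close> against the mixture, which replaces the
  unknown \<open>W\<close>; the same set therefore serves all \<open>W\<close> at once.\<close>

definition universal_test :: "(int \<Rightarrow> 'a::finite) measure \<Rightarrow> real \<Rightarrow> nat \<Rightarrow> 'a list set" where
  "universal_test Q c n = {w \<in> words n. marg Q n {w} \<le> exp (- (n * c)) * universal_weight n w}"

lemma marg_universal_test_le:
  fixes Q :: "(int \<Rightarrow> 'a::finite) measure"
  assumes "is_process Q"
  shows "marg Q n (universal_test Q c n) \<le> exp (- (n * c))"
proof -
  have "marg Q n (universal_test Q c n) = (\<Sum>w\<in>universal_test Q c n. marg Q n {w})"
    using assms by (intro marg_sum) (auto simp: universal_test_def)
  also have "\<dots> \<le> (\<Sum>w\<in>universal_test Q c n. exp (- (n * c)) * universal_weight n w)"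
    by (intro sum_mono) (auto simp: universal_test_def)
  also have "\<dots> \<le> (\<Sum>w\<in>words n. exp (- (n * c)) * universal_weight n (w :: 'a list))"
    by (intro sum_mono2) (auto simp: universal_test_def universal_weight_nonneg)
  also have "\<dots> \<le> exp (- (n * c))"
    using sum_universal_weight_le[where 'a = 'a and n = n] by (simp add: sum_distrib_left[symmetric])
  finally show ?thesis .
qed

text \<open>Let \<open>M\<close> attain \<open>beta\<close>. A word of \<open>M\<close> that fails
  the test and at which the mixture dominates \<open>W\<close> has \<open>Q\<close>-probability not
  much below its \<open>W\<close>-probability. Such words carry little \<open>W\<close>-mass, since
  \<open>Q\<close> gives little mass to \<open>M\<close>.\<close>

lemma universal_test_typical:
  fixes W Q :: "(int \<Rightarrow> 'a::finite) measure"
  assumes Q: "is_process Q" and W: "stationary W" and c: "c < c'"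
    and beta: "\<And>\<epsilon>. 0 < \<epsilon> \<Longrightarrow> \<epsilon> < 1 \<Longrightarrow> beta_bar \<epsilon> W Q \<le> ereal (- c')"
  shows "(\<lambda>n. marg W n (universal_test Q c n)) \<longlonglongrightarrow> 1"
proof -
  have pW: "is_process W" using W by (simp add: stationary_def)
  \<comment> \<open>The gap is split in three: one \<open>d\<close> makes the bound on the limsup
    strict, one pays for the mixture in place of \<open>W\<close>, and one remains as exponential
    decay.\<close>
  define d where "d = (c' - c) / 3"
  have d: "0 < d" "c + 3 * d = c'" using c by (auto simp: d_def field_simps)
  let ?G = "\<lambda>n. {w \<in> words n. universal_weight n w < exp (- (n * d)) * marg W n {w}}"
  let ?B = "\<lambda>n. words n - universal_test Q c n"
  have "eventually (\<lambda>n. marg W n (?B n) < e) sequentially" if e: "0 < e" for e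
  proof -
    \<comment> \<open>A level in the range of the assumption on \<open>beta_bar\<close>, and at most
      one of three equal shares of the error \<open>e\<close>.\<close>
    define \<epsilon> where "\<epsilon> = min (1/2) (e/3)"
    have \<epsilon>: "0 < \<epsilon>" "\<epsilon> < 1" "\<epsilon> \<le> e / 3" using e by (auto simp: \<epsilon>_def)
    have "beta_bar \<epsilon> W Q < ereal (- (c + 2 * d))"
      using beta[OF \<epsilon>(1,2)] d by (elim order_le_less_trans) simp
    then have 1: "eventually (\<lambda>n. ereal (1 / real n) * beta \<epsilon> n W Q < ereal (- (c + 2 * d))) sequentially"
      unfolding beta_bar_def by (rule Limsup_lessD)
    have 2: "eventually (\<lambda>n. marg W n (?G n) < e / 3) sequentially"
      using universal_weight_dominates[OF W d(1)] e by (intro order_tendstoD) auto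
    have "(\<lambda>n. exp (- d) ^ n) \<longlonglongrightarrow> 0" using d by (intro LIMSEQ_realpow_zero) auto
    then have "eventually (\<lambda>n. exp (- d) ^ n < e / 3) sequentially"
      using e by (intro order_tendstoD) auto
    with 1 2 eventually_gt_at_top[of 0] show ?thesis
    proof eventually_elim
      case (elim n)
      obtain M where M: "M \<subseteq> words n" "1 - \<epsilon> \<le> marg W n M" "beta \<epsilon> n W Q = elog (marg Q n M)"
        using beta_attained[OF pW, of \<epsilon> n Q] \<epsilon> by auto
      have QM: "marg Q n M \<le> exp (- (n * (c + 2 * d)))"
        using elim M(3) by (intro elog_rate_lessD) auto
      \<comment> \<open>The words of \<open>M\<close> at which \<open>W\<close> exceeds
        \<open>Q\<close> by at most the factor \<open>exp (n * (c + d))\<close>; their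
        \<open>W\<close>-mass is at most this factor times \<open>marg Q n M\<close>.\<close>
      let ?R = "{w \<in> M. exp (- (n * (c + d))) * marg W n {w} \<le> marg Q n {w}}"
      have "marg W n ?R = (\<Sum>w\<in>?R. marg W n {w})" using M pW by (intro marg_sum) auto
      also have "\<dots> \<le> (\<Sum>w\<in>?R. exp (n * (c + d)) * marg Q n {w})"
      proof (rule sum_mono)
        fix w assume "w \<in> ?R"
        then have "exp (n * (c + d)) * (exp (- (n * (c + d))) * marg W n {w}) \<le> exp (n * (c + d)) * marg Q n {w}"
          by (intro mult_left_mono) auto
        then show "marg W n {w} \<le> exp (n * (c + d)) * marg Q n {w}"
          by (simp only: mult.assoc[symmetric] mult_exp_exp) simp
      qed
      also have "\<dots> = exp (n * (c + d)) * marg Q n ?R"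
        using M Q by (subst marg_sum[of Q ?R n]) (auto simp: sum_distrib_left)
      also have "\<dots> \<le> exp (n * (c + d)) * exp (- (n * (c + 2 * d)))"
        using QM marg_mono[OF Q _ M(1), of ?R] by (intro mult_left_mono) auto
      also have "\<dots> = exp (- d) ^ n"
        by (simp add: mult_exp_exp exp_of_nat_mult[symmetric] algebra_simps)
      finally have R: "marg W n ?R < e / 3" using elim by simp
      have "?B n \<subseteq> (words n - M) \<union> ?G n \<union> ?R"
      proof
        fix w assume w: "w \<in> ?B n"
        show "w \<in> (words n - M) \<union> ?G n \<union> ?R"
        proof (cases "w \<in> ?G n \<or> w \<notin> M")
          case False
          then have "exp (- (n * c)) * (exp (- (n * d)) * marg W n {w}) \<le> exp (- (n * c)) * universal_weight n w"
            using w by (intro mult_left_mono) auto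
          also have "\<dots> \<le> marg Q n {w}" using w by (auto simp: universal_test_def)
          finally have "exp (- (n * c) + - (n * d)) * marg W n {w} \<le> marg Q n {w}"
            by (simp only: mult.assoc[symmetric] mult_exp_exp)
          then have "exp (- (n * (c + d))) * marg W n {w} \<le> marg Q n {w}"
            by (simp add: distrib_left)
          then show ?thesis using False by auto
        qed (use w in auto)
      qed
      then have "marg W n (?B n) \<le> marg W n ((words n - M) \<union> ?G n \<union> ?R)"
        using M by (intro marg_mono[OF pW]) auto
      also have "\<dots> \<le> marg W n ((words n - M) \<union> ?G n) + marg W n ?R"
        using M by (intro marg_Un_le[OF pW]) auto
      also have "\<dots> \<le> marg W n (words n - M) + marg W n (?G n) + marg W n ?R"
        using marg_Un_le[OF pW, of "words n - M" n "?G n"] M by auto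
      also have "\<dots> < e" using R elim marg_compl[OF pW M(1)] M(2) \<epsilon>(3) by linarith
      finally show ?case .
    qed
  qed
  then have "(\<lambda>n. marg W n (?B n)) \<longlonglongrightarrow> 0"
    by (intro order_tendstoI) (auto intro!: always_eventually simp: less_le_trans)
  then have "(\<lambda>n. 1 - marg W n (?B n)) \<longlonglongrightarrow> 1 - 0" by (intro tendsto_diff tendsto_const)
  moreover have "1 - marg W n (?B n) = marg W n (universal_test Q c n)" for n
    using marg_compl[OF pW, of "universal_test Q c n" n] by (auto simp: universal_test_def)
  ultimately show ?thesis by simp
qed

subsection \<open>Ergodic decompositions\<close>

lemma decomposition_process:
  assumes "ergodic_decomposition P \<gamma>" "W \<in> space \<gamma>"
  shows "is_process W"
  using assms sets_eq_imp_space_eq[of \<gamma> "prob_algebra cyl"]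
  by (auto simp: ergodic_decomposition_def space_prob_algebra is_process_def)

lemma decomposition_marg:
  assumes dec: "ergodic_decomposition P \<gamma>" and P: "is_process P" and M: "M \<subseteq> words n"
  shows "integrable \<gamma> (\<lambda>W. marg W n M)" "marg P n M = (\<integral>W. marg W n M \<partial>\<gamma>)"
proof -
  interpret prob_space \<gamma> using dec by (simp add: ergodic_decomposition_def)
  have eq: "marg W n M = measure W {x. word n x \<in> M}" if "W \<in> space \<gamma>" for W
    using decomposition_process[OF dec that] by (simp add: marg_process)
  have "(\<lambda>W. measure W {x. word n x \<in> M}) \<in> borel_measurable \<gamma>"
    using dec measurable_measure_prob_algebra[OF cylinder_sets[of n M]]
    by (simp add: ergodic_decomposition_def cong: measurable_cong_sets)
  then have m: "(\<lambda>W. marg W n M) \<in> borel_measurable \<gamma>" using eq by (simp cong: measurable_cong)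
  show "integrable \<gamma> (\<lambda>W. marg W n M)"
    using m marg_le_1[OF decomposition_process[OF dec] M]
    by (intro integrable_const_bound[where B = 1]) auto
  show "marg P n M = (\<integral>W. marg W n M \<partial>\<gamma>)"
    using dec eq cylinder_sets[of n M] P
    by (simp add: ergodic_decomposition_def marg_process cong: Bochner_Integration.integral_cong)
qed

text \<open>Dominated convergence with the constant bound 1 carries typicality from the components
  to \<open>P\<close>.\<close>

lemma decomposition_marg_tendsto:
  assumes dec: "ergodic_decomposition P \<gamma>" and P: "is_process P" and M: "\<And>n. M n \<subseteq> words n"
    and lim: "AE W in \<gamma>. (\<lambda>n. marg W n (M n)) \<longlonglongrightarrow> 1"
  shows "(\<lambda>n. marg P n (M n)) \<longlonglongrightarrow> 1"
proof -
  interpret prob_space \<gamma> using dec by (simp add: ergodic_decomposition_def)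
  have "(\<lambda>n. \<integral>W. marg W n (M n) \<partial>\<gamma>) \<longlonglongrightarrow> (\<integral>W. 1 \<partial>\<gamma>)"
    using decomposition_marg(1)[OF dec P M] lim marg_le_1[OF decomposition_process[OF dec] M]
    by (intro integral_dominated_convergence[where w = "\<lambda>_. 1"]) auto
  then show ?thesis by (simp add: decomposition_marg(2)[OF dec P M] prob_space)
qed

text \<open>As \<open>1 - marg W n M\<close> is nonnegative, convergence of its mean is convergence
  in L1, hence almost everywhere along a subsequence common to almost all \<open>W\<close>. Starting
  from a given \<open>r\<close> allows \<open>r\<close> to realise a liminf.\<close>

lemma decomposition_marg_subseq:
  assumes dec: "ergodic_decomposition P \<gamma>" and P: "is_process P" and M: "\<And>n. M n \<subseteq> words n"
    and lim: "(\<lambda>n. marg P n (M n)) \<longlonglongrightarrow> 1" and r: "strict_mono (r :: nat \<Rightarrow> nat)"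
  shows "\<exists>s :: nat \<Rightarrow> nat. strict_mono s
    \<and> (AE W in \<gamma>. (\<lambda>i. marg W (r (s i)) (M (r (s i)))) \<longlonglongrightarrow> 1)"
proof -
  interpret prob_space \<gamma> using dec by (simp add: ergodic_decomposition_def)
  let ?u = "\<lambda>i W. 1 - marg W (r i) (M (r i))"
  have int: "integrable \<gamma> (?u i)" for i using decomposition_marg(1)[OF dec P M] by simp
  have "(\<integral>W. norm (?u i W) \<partial>\<gamma>) = 1 - marg P (r i) (M (r i))" for i
  proof -
    have "(\<integral>W. norm (?u i W) \<partial>\<gamma>) = (\<integral>W. ?u i W \<partial>\<gamma>)"
      using marg_le_1[OF decomposition_process[OF dec] M] by (intro Bochner_Integration.integral_cong) auto
    also have "\<dots> = 1 - marg P (r i) (M (r i))"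
      using decomposition_marg[OF dec P M] by (simp add: prob_space)
    finally show ?thesis .
  qed
  moreover have "(\<lambda>i. 1 - marg P (r i) (M (r i))) \<longlonglongrightarrow> 1 - 1"
    using LIMSEQ_subseq_LIMSEQ[OF lim r] by (intro tendsto_diff tendsto_const) (simp add: o_def)
  ultimately have "(\<lambda>i. \<integral>W. norm (?u i W) \<partial>\<gamma>) \<longlonglongrightarrow> 0" by simp
  from tendsto_L1_AE_subseq[OF int this] obtain s :: "nat \<Rightarrow> nat"
    where s: "strict_mono s" "AE W in \<gamma>. (\<lambda>i. ?u (s i) W) \<longlonglongrightarrow> 0" by blast
  from s(2) have "AE W in \<gamma>. (\<lambda>i. marg W (r (s i)) (M (r (s i)))) \<longlonglongrightarrow> 1"
  proof eventually_elim
    case (elim W)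
    then have "(\<lambda>i. 1 - ?u (s i) W) \<longlonglongrightarrow> 1 - 0" by (intro tendsto_diff tendsto_const)
    then show ?case by simp
  qed
  with s(1) show ?thesis by blast
qed

subsection \<open>The converse bound\<close>

text \<open>A single infinite summand makes the sum infinite, so finiteness forces absolute
  continuity on words of length \<open>n\<close>.\<close>

lemma KL_finite:
  assumes "KL W Q n \<noteq> \<infinity>"
  shows "\<And>w. w \<in> words n \<Longrightarrow> 0 < marg W n {w} \<Longrightarrow> 0 < marg Q n {w}"
    and "KL W Q n = ereal (\<Sum>w\<in>words n. marg W n {w} * (ln (marg W n {w}) - ln (marg Q n {w})))"
proof -
  let ?f = "\<lambda>w. if marg W n {w} = 0 then 0 else if marg Q n {w} = 0 then \<infinity>
     else ereal (marg W n {w} * ln (marg W n {w} / marg Q n {w}))"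
  have KL: "KL W Q n = (\<Sum>w\<in>words n. ?f w)" by (simp add: KL_def Let_def)
  have fin: "?f w \<noteq> \<infinity>" if "w \<in> words n" for w
    using assms that unfolding KL sum_Pinfty by auto
  show pos: "0 < marg Q n {w}" if "w \<in> words n" "0 < marg W n {w}" for w
    using fin[OF that(1)] that(2) marg_nonneg[of Q n "{w}"] by (auto split: if_splits simp: less_le)
  have "?f w = ereal (marg W n {w} * (ln (marg W n {w}) - ln (marg Q n {w})))" if w: "w \<in> words n" for w
  proof (cases "marg W n {w} = 0")
    case False
    then have p: "0 < marg W n {w}" using marg_nonneg[of W n "{w}"] by linarith
    with pos[OF w] show ?thesis by (simp add: ln_div)
  qed simp
  then show "KL W Q n = ereal (\<Sum>w\<in>words n. marg W n {w} * (ln (marg W n {w}) - ln (marg Q n {w})))"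
    unfolding KL sum_ereal[symmetric] by (intro sum.cong) auto
qed

lemma KL_nonneg:
  assumes W: "is_process W" and Q: "is_process Q"
  shows "0 \<le> KL W Q n"
proof (cases "KL W Q n = \<infinity>")
  case False
  note fin = KL_finite[OF False]
  have "0 = (\<Sum>w\<in>words n. marg W n {w} - marg Q n {w})"
    by (simp add: sum_subtractf sum_marg_words[OF W] sum_marg_words[OF Q])
  also have "\<dots> \<le> (\<Sum>w\<in>words n. marg W n {w} * (ln (marg W n {w}) - ln (marg Q n {w})))"
    using fin(1) by (intro sum_mono mult_ln_diff_ge) auto
  finally show ?thesis using fin(2) by simp
qed simp

text \<open>On \<open>M\<close>, \<open>W\<close> is compared with \<open>Q\<close> conditioned on
  \<open>M\<close>; off \<open>M\<close>, with \<open>Q\<close> itself. Each comparison loses at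
  most 1, which is negligible after division by \<open>n\<close>.\<close>

lemma KL_lower_bound:
  assumes W: "is_process W" and Q: "is_process Q" and M: "M \<subseteq> words n"
    and fin: "KL W Q n \<noteq> \<infinity>" and pos: "0 < marg W n M"
  shows "0 < marg Q n M" "ereal (- marg W n M * ln (marg Q n M) - 2) \<le> KL W Q n"
proof -
  note fin = KL_finite[OF fin]
  from pos have "(\<Sum>w\<in>M. marg W n {w}) \<noteq> 0" using marg_sum[OF W M] by simp
  then obtain w where w: "w \<in> M" "marg W n {w} \<noteq> 0" by (metis sum.neutral)
  then have "0 < marg Q n {w}" using fin(1)[of w] M marg_nonneg[of W n "{w}"] by (auto simp: less_le)
  also have "\<dots> \<le> marg Q n M" using w M by (intro marg_mono[OF Q]) auto
  finally show t: "0 < marg Q n M" .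
  let ?t = "marg Q n M"
  let ?f = "\<lambda>w. marg W n {w} * (ln (marg W n {w}) - ln (marg Q n {w}))"
  have "- 1 \<le> marg W n M - 1" by simp
  also have "\<dots> = (\<Sum>w\<in>M. marg W n {w} - marg Q n {w} / ?t)"
    using t marg_sum[OF W M] marg_sum[OF Q M] by (simp add: sum_subtractf sum_divide_distrib[symmetric])
  also have "\<dots> \<le> (\<Sum>w\<in>M. ?f w + marg W n {w} * ln ?t)"
  proof (rule sum_mono)
    fix w assume w: "w \<in> M"
    show "marg W n {w} - marg Q n {w} / ?t \<le> ?f w + marg W n {w} * ln ?t"
    proof (cases "marg W n {w} = 0")
      case False
      then have p: "0 < marg W n {w}" using marg_nonneg[of W n "{w}"] by linarith
      then have q: "0 < marg Q n {w}" using fin(1) w M by auto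
      have "marg W n {w} - marg Q n {w} / ?t \<le> marg W n {w} * (ln (marg W n {w}) - ln (marg Q n {w} / ?t))"
        using p q t by (intro mult_ln_diff_ge) auto
      also have "\<dots> = ?f w + marg W n {w} * ln ?t" using q t by (simp add: ln_div algebra_simps)
      finally show ?thesis .
    qed (use t in simp)
  qed
  also have "\<dots> = (\<Sum>w\<in>M. ?f w) + marg W n M * ln ?t"
    using marg_sum[OF W M] by (simp add: sum.distrib sum_distrib_right)
  finally have 1: "- 1 - marg W n M * ln ?t \<le> (\<Sum>w\<in>M. ?f w)" by simp
  have "- 1 \<le> marg W n (words n - M) - marg Q n (words n - M)"
    using marg_le_1[OF Q Diff_subset, of n M] marg_nonneg[of W n "words n - M"] by linarith
  also have "\<dots> = (\<Sum>w\<in>words n - M. marg W n {w} - marg Q n {w})"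
    using W Q by (simp only: marg_sum[of _ "words n - M" n] Diff_subset sum_subtractf)
  also have "\<dots> \<le> (\<Sum>w\<in>words n - M. ?f w)"
    using fin(1) by (intro sum_mono mult_ln_diff_ge) auto
  finally have 2: "- 1 \<le> (\<Sum>w\<in>words n - M. ?f w)" .
  have "(\<Sum>w\<in>words n. ?f w) = (\<Sum>w\<in>words n - M. ?f w) + (\<Sum>w\<in>M. ?f w)"
    using M by (intro sum.subset_diff) auto
  with 1 2 show "ereal (- marg W n M * ln ?t - 2) \<le> KL W Q n" unfolding fin(2) by simp
qed

lemma rel_rate_limit:
  "rel_rate_exists W Q \<Longrightarrow> (\<lambda>n. ereal (1 / real n) * KL W Q n) \<longlonglongrightarrow> rel_rate W Q"
  unfolding rel_rate_exists_def rel_rate_def using convergent_LIMSEQ_iff convergent_def by blast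

lemma rel_rate_nonneg:
  assumes "is_process W" "is_process Q" "rel_rate_exists W Q"
  shows "0 \<le> rel_rate W Q"
  using rel_rate_limit[OF assms(3)] KL_nonneg[OF assms(1,2)]
  by (intro LIMSEQ_le_const) (auto intro!: ereal_0_le_mult)

text \<open>If the rate were below some \<open>b < a\<close>, dividing the lower bound on
  \<open>KL\<close> by the word length would give \<open>a \<le> b\<close> in the limit. A
  subsequence \<open>r\<close> is allowed because components inherit typicality only along
  one.\<close>

lemma no_fast_decay:
  assumes W: "is_process W" and Q: "is_process Q" and ex: "rel_rate_exists W Q"
    and M: "\<And>n. M n \<subseteq> words n" and r: "strict_mono (r :: nat \<Rightarrow> nat)"
    and lim: "(\<lambda>i. marg W (r i) (M (r i))) \<longlonglongrightarrow> 1"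
    and decay: "eventually (\<lambda>i. ereal (1 / real (r i)) * elog (marg Q (r i) (M (r i))) < ereal (- a)) sequentially"
  shows "ereal a \<le> rel_rate W Q"
proof (rule ccontr)
  assume "\<not> ereal a \<le> rel_rate W Q"
  then obtain b where b: "rel_rate W Q < ereal b" "b < a"
    using ereal_dense2[of "rel_rate W Q" "ereal a"] by (auto simp: not_le)
  have "(\<lambda>i. ereal (1 / real (r i)) * KL W Q (r i)) \<longlonglongrightarrow> rel_rate W Q"
    using LIMSEQ_subseq_LIMSEQ[OF rel_rate_limit[OF ex] r] by (simp add: o_def)
  then have K: "eventually (\<lambda>i. ereal (1 / real (r i)) * KL W Q (r i) < ereal b) sequentially"
    using b by (intro order_tendstoD)
  have rtop: "filterlim r at_top sequentially" by (rule filterlim_subseq[OF r])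
  have rpos: "eventually (\<lambda>i. 0 < r i) sequentially"
    using rtop eventually_gt_at_top[of 0] by (auto simp: filterlim_iff)
  have mpos: "eventually (\<lambda>i. 0 < marg W (r i) (M (r i))) sequentially"
    using lim by (intro order_tendstoD) auto
  have "eventually (\<lambda>i. marg W (r i) (M (r i)) * a - 2 / real (r i) \<le> b) sequentially"
    using K rpos mpos decay
  proof eventually_elim
    case (elim i)
    let ?n = "r i" let ?M = "M (r i)"
    \<comment> \<open>The upper bound by the real number \<open>b\<close> excludes an infinite
      divergence.\<close>
    have fin: "KL W Q ?n \<noteq> \<infinity>" using elim by auto
    note low = KL_lower_bound[OF W Q M fin elim(3)]
    from KL_finite(2)[OF fin] obtain k where k: "KL W Q ?n = ereal k" by auto
    have "marg Q ?n ?M \<le> exp (- (?n * a))" using elim by (intro elog_rate_lessD) auto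
    then have "ln (marg Q ?n ?M) \<le> - (?n * a)" using low(1) by (metis exp_gt_zero ln_exp ln_le_cancel_iff)
    then have "marg W ?n ?M * ln (marg Q ?n ?M) \<le> marg W ?n ?M * - (?n * a)"
      using elim by (intro mult_left_mono) auto
    with low(2) k have "marg W ?n ?M * (?n * a) - 2 \<le> k" by simp
    moreover have "k < ?n * b" using elim k by (simp add: field_simps)
    ultimately have "marg W ?n ?M * (?n * a) - 2 \<le> ?n * b" by linarith
    then have "(marg W ?n ?M * (?n * a) - 2) / ?n \<le> (?n * b) / ?n" by (intro divide_right_mono) auto
    then show ?case using elim by (simp add: diff_divide_distrib)
  qed
  moreover have "(\<lambda>i. marg W (r i) (M (r i)) * a - 2 / real (r i)) \<longlonglongrightarrow> 1 * a - 0"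
    using LIMSEQ_subseq_LIMSEQ[OF lim_const_over_n[of "2 :: real"] r]
    by (intro tendsto_diff tendsto_mult lim tendsto_const) (simp add: o_def)
  ultimately have "1 * a - 0 \<le> b" by (intro tendsto_upperbound[of _ _ sequentially]) auto
  with b show False by simp
qed

section \<open>Nonnegativity, universal typical sets and the converse for a family of
  processes\<close>

theorem mainTheorem6:
  fixes Q :: "(int \<Rightarrow> 'a::finite) measure"
    and \<Theta> :: "(int \<Rightarrow> 'a) measure set"
    and \<gamma> :: "(int \<Rightarrow> 'a) measure \<Rightarrow> (int \<Rightarrow> 'a) measure measure"
  assumes Q: "is_process Q"
    and stat: "\<And>P. P \<in> \<Theta> \<Longrightarrow> stationary P"
    and decomp: "\<And>P. P \<in> \<Theta> \<Longrightarrow> ergodic_decomposition P (\<gamma> P)"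
    and hyp: "\<And>P. P \<in> \<Theta> \<Longrightarrow> AE W in \<gamma> P. rel_rate_exists W Q \<and>
               (\<forall>\<epsilon>. 0 < \<epsilon> \<and> \<epsilon> < 1 \<longrightarrow> beta_bar \<epsilon> W Q \<le> - rel_rate W Q)"
  shows "(\<forall>P \<in> \<Theta>. 0 \<le> h_low (\<gamma> P) Q)
    \<and> (\<forall>\<Omega> \<subseteq> \<Theta>. \<forall>\<eta>::real. \<eta> > 0 \<longrightarrow>
         (\<exists>M :: nat \<Rightarrow> 'a list set. (\<forall>n. M n \<subseteq> words n)
            \<and> (\<forall>P \<in> \<Omega>. (\<lambda>n. marg P n (M n)) \<longlonglongrightarrow> 1)
            \<and> (h_low_set \<gamma> \<Omega> Q < \<infinity> \<longrightarrow>
                 limsup (\<lambda>n. ereal (1 / real n) * elog (marg Q n (M n)))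
                   \<le> - h_low_set \<gamma> \<Omega> Q + ereal \<eta>)
            \<and> (h_low_set \<gamma> \<Omega> Q = \<infinity> \<longrightarrow>
                 limsup (\<lambda>n. ereal (1 / real n) * elog (marg Q n (M n))) \<le> ereal (- 1 / \<eta>))))
    \<and> (\<forall>\<Omega> \<subseteq> \<Theta>. \<forall>M' :: nat \<Rightarrow> 'a list set.
         (\<forall>n. M' n \<subseteq> words n) \<longrightarrow> (\<forall>P \<in> \<Omega>. (\<lambda>n. marg P n (M' n)) \<longlonglongrightarrow> 1) \<longrightarrow>
         liminf (\<lambda>n. ereal (1 / real n) * elog (marg Q n (M' n))) \<ge> - h_low_set \<gamma> \<Omega> Q)"
proof (intro conjI ballI allI impI)
  have good: "AE W in \<gamma> P. stationary W \<and> rel_rate_exists W Q \<and>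
      (\<forall>\<epsilon>. 0 < \<epsilon> \<and> \<epsilon> < 1 \<longrightarrow> beta_bar \<epsilon> W Q \<le> - rel_rate W Q)" if "P \<in> \<Theta>" for P
  proof -
    have "AE W in \<gamma> P. ergodic W" using decomp[OF that] by (simp add: ergodic_decomposition_def)
    with hyp[OF that] show ?thesis by eventually_elim (auto simp: ergodic_def)
  qed
  have proc: "is_process P" if "P \<in> \<Theta>" for P using stat[OF that] by (simp add: stationary_def)
  show nonneg: "0 \<le> h_low (\<gamma> P) Q" if P: "P \<in> \<Theta>" for P
  proof -
    have "AE W in \<gamma> P. 0 \<le> rel_rate W Q"
      using good[OF P] by eventually_elim (auto intro: rel_rate_nonneg[OF _ Q] simp: stationary_def)
    then show ?thesis unfolding h_low_def ess_inf_def by (intro Sup_upper) auto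
  qed
  show "\<exists>M :: nat \<Rightarrow> 'a list set. (\<forall>n. M n \<subseteq> words n)
      \<and> (\<forall>P \<in> \<Omega>. (\<lambda>n. marg P n (M n)) \<longlonglongrightarrow> 1)
      \<and> (h_low_set \<gamma> \<Omega> Q < \<infinity> \<longrightarrow>
           limsup (\<lambda>n. ereal (1 / real n) * elog (marg Q n (M n))) \<le> - h_low_set \<gamma> \<Omega> Q + ereal \<eta>)
      \<and> (h_low_set \<gamma> \<Omega> Q = \<infinity> \<longrightarrow>
           limsup (\<lambda>n. ereal (1 / real n) * elog (marg Q n (M n))) \<le> ereal (- 1 / \<eta>))"
    if sub: "\<Omega> \<subseteq> \<Theta>" and \<eta>: "0 < \<eta>" for \<Omega> and \<eta> :: real
  proof -
    let ?h = "h_low_set \<gamma> \<Omega> Q"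
    have h0: "0 \<le> ?h" unfolding h_low_set_def using nonneg sub by (intro INF_greatest) auto
    \<comment> \<open>The target exponent, strictly below \<open>?h\<close> in both cases. It may be
      negative if \<open>?h < \<eta>\<close>; an empty \<open>\<Omega>\<close> falls under
      \<open>?h = \<infinity>\<close>.\<close>
    define c where "c = (if ?h = \<infinity> then 1 / \<eta> else real_of_ereal ?h - \<eta>)"
    have ch: "ereal c < ?h" using h0 \<eta> by (cases ?h) (auto simp: c_def)
    then obtain c' where c': "ereal c < ereal c'" "ereal c' < ?h" using ereal_dense2 by blast
    have typical: "(\<lambda>n. marg P n (universal_test Q c n)) \<longlonglongrightarrow> 1" if P: "P \<in> \<Omega>" for P
    proof (rule decomposition_marg_tendsto)
      have PT: "P \<in> \<Theta>" using P sub by auto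
      show "ergodic_decomposition P (\<gamma> P)" "is_process P" using decomp proc PT by auto
      show "universal_test Q c n \<subseteq> words n" for n by (auto simp: universal_test_def)
      have "?h \<le> h_low (\<gamma> P) Q" unfolding h_low_set_def using P by (rule INF_lower)
      with c'(2) have "ereal c' < h_low (\<gamma> P) Q" by (rule less_le_trans)
      \<comment> \<open>As \<open>ess_inf\<close> is a supremum of almost sure lower bounds, one of
        them exceeds \<open>c'\<close>.\<close>
      then obtain d where d: "ereal c' < d" "AE W in \<gamma> P. d \<le> rel_rate W Q"
        unfolding h_low_def ess_inf_def less_Sup_iff by auto
      from d(2) good[OF PT] show "AE W in \<gamma> P. (\<lambda>n. marg W n (universal_test Q c n)) \<longlonglongrightarrow> 1"
      proof eventually_elim
        case (elim W)
        have "- rel_rate W Q \<le> ereal (- c')"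
          using d(1) elim(1) by (simp flip: uminus_ereal.simps(1))
        with elim(2) c' show ?case by (intro universal_test_typical[OF Q]) (auto intro: order_trans)
      qed
    qed
    have "eventually (\<lambda>n. ereal (1 / real n) * elog (marg Q n (universal_test Q c n)) \<le> ereal (- c)) sequentially"
      using eventually_gt_at_top[of 0]
      by eventually_elim (intro elog_rate_leI marg_universal_test_le[OF Q])
    then have "limsup (\<lambda>n. ereal (1 / real n) * elog (marg Q n (universal_test Q c n))) \<le> ereal (- c)"
      by (rule Limsup_bounded)
    then show ?thesis using typical h0 \<eta>
      by (intro exI[of _ "universal_test Q c"], cases ?h) (auto simp: c_def universal_test_def)
  qed
  show "- h_low_set \<gamma> \<Omega> Q \<le> liminf (\<lambda>n. ereal (1 / real n) * elog (marg Q n (M n)))"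
    if sub: "\<Omega> \<subseteq> \<Theta>" and M: "\<forall>n. M n \<subseteq> words n" and lim: "\<forall>P \<in> \<Omega>. (\<lambda>n. marg P n (M n)) \<longlonglongrightarrow> 1"
    for \<Omega> and M :: "nat \<Rightarrow> 'a list set"
  proof -
    let ?f = "\<lambda>n. ereal (1 / real n) * elog (marg Q n (M n))"
    \<comment> \<open>Bounding by each \<open>h_low (\<gamma> P) Q\<close> suffices, as
      \<open>h_low_set\<close> is their infimum.\<close>
    have "- liminf ?f \<le> h_low (\<gamma> P) Q" if P: "P \<in> \<Omega>" for P
    proof (rule ccontr)
      have PT: "P \<in> \<Theta>" using P sub by auto
      assume "\<not> - liminf ?f \<le> h_low (\<gamma> P) Q"
      then obtain a where a: "h_low (\<gamma> P) Q < ereal a" "ereal a < - liminf ?f"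
        using ereal_dense2 by (meson not_le)
      have a': "liminf ?f < ereal (- a)" using a(2) by (metis ereal_less_uminus_reorder uminus_ereal.simps(1))
      \<comment> \<open>First \<open>r\<close> realises the liminf, then \<open>s\<close> thins it
        out until the sets are typical for almost every component of \<open>P\<close>.\<close>
      obtain r :: "nat \<Rightarrow> nat" where r: "strict_mono r" "(?f \<circ> r) \<longlonglongrightarrow> liminf ?f"
        using liminf_subseq_lim by blast
      have limP: "(\<lambda>n. marg P n (M n)) \<longlonglongrightarrow> 1" using lim P by blast
      obtain s :: "nat \<Rightarrow> nat" where s: "strict_mono s"
          "AE W in \<gamma> P. (\<lambda>i. marg W (r (s i)) (M (r (s i)))) \<longlonglongrightarrow> 1"
        using decomposition_marg_subseq[OF decomp[OF PT] proc[OF PT] _ limP r(1)] M by blast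
      have rs: "strict_mono (r \<circ> s)" using r(1) s(1) by (rule strict_mono_o)
      have "(?f \<circ> r \<circ> s) \<longlonglongrightarrow> liminf ?f" using r(2) s(1) by (rule LIMSEQ_subseq_LIMSEQ)
      then have decay: "eventually (\<lambda>i. ?f ((r \<circ> s) i) < ereal (- a)) sequentially"
        using a' by (auto dest: order_tendstoD simp: o_def)
      from s(2) good[OF PT] have "AE W in \<gamma> P. ereal a \<le> rel_rate W Q"
      proof eventually_elim
        case (elim W)
        with M decay rs show ?case
          by (intro no_fast_decay[where r = "r \<circ> s" and M = M, OF _ Q]) (auto simp: stationary_def o_def)
      qed
      \<comment> \<open>An almost sure lower bound is at most the essential infimum, contrary to the
        choice of \<open>a\<close>.\<close>
      then have "ereal a \<le> h_low (\<gamma> P) Q"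
        unfolding h_low_def ess_inf_def by (intro Sup_upper) simp
      with a(1) show False by simp
    qed
    then have "- liminf ?f \<le> h_low_set \<gamma> \<Omega> Q" unfolding h_low_set_def by (intro INF_greatest)
    then show ?thesis by (simp add: ereal_uminus_le_reorder)
  qed
qed

end
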